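(* Let $\mathcal{K}(\mathbb{E}_2)\cong\mathbb{R}^6$ be the space of Killing $2$-tensors of the Euclidean plane with coordinates $(A,B,C,\alpha,\beta,\gamma)$, let $\Delta_E$ be the distribution spanned by $V_1,\dots,V_6$, let $G_E$ be the web-type preserving group, and let $S_3$ be the line defined in the context. The rank of the distribution $\Delta_E$ on $S_3$ is $1$, and $S_3$ is an orbit of the action of $G_E$ on $\mathcal{K}(\mathbb{E}_2)$, containing the (non-characteristic) tensors of the form $\tau\,\mathbf{g}$, $\tau\in\mathbb{R}$.
   Context: In the Euclidean plane $\mathbb{E}_2$ with Cartesian coordinates $(x,y)$ and standard metric $\mathbf{g}$, the general Killing $2$-tensor has contravariant components $K^{11}=A+2\alpha y+\gamma y^2$, $K^{12}=K^{21}=C-\alpha x-\beta y-\gamma xy$, $K^{22}=B+2\beta x+\gamma x^2$, with $A,B,C,\alpha,\beta,\gamma\in\mathbb{R}$. So the vector space $\mathcal{K}(\mathbb{E}_2)$ of Killing $2$-tensors is identified with $\mathbb{R}^6$ with coordinates $(A,B,C,\alpha,\beta,\gamma)$. A Killing $2$-tensor is called characteristic if its eigenvalues are real and simple and its eigenvectors are normal (orthogonally integrable). With respect to $(\partial_A,\partial_B,\partial_C,\partial_\alpha,\partial_\beta,\partial_\gamma)$ define the following vector fields on $\mathcal{K}(\mathbb{E}_2)$, generating the transformations which preserve the type of the web: $V_1=(0,-2\beta,\alpha,0,-\gamma,0)$ and $V_2=(-2\alpha,0,\beta,-\gamma,0,0)$ (translations); $V_3=(-2C,2C,A-B,\beta,-\alpha,0)$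 (rotation); $V_4=(2A,2B,2C,\alpha,\beta,0)$ (dilatation of the plane); $V_5=(1,1,0,0,0,0)$ (addition of a multiple of the metric, $\mathbf{K}\mapsto\mathbf{K}+\tau\mathbf{g}$); $V_6=(A,B,C,\alpha,\beta,\gamma)$ (scalar multiplication, $\mathbf{K}\mapsto\lambda\mathbf{K}$). $\Delta_E$ is the distribution spanned by $V_1,\dots,V_6$; its rank at a point is the dimension of the span of the values of $V_1,\dots,V_6$ at that point. $G_E$ is the group of transformations of $\mathcal{K}(\mathbb{E}_2)$ generated by the flows of $V_1,\dots,V_6$ together with the change of sign $\mathbf{K}\mapsto-\mathbf{K}$. $S_3=\{\alpha=\beta=\gamma=0,\ C=0,\ A=B\}$. *)

theory Defs
  imports
    "HOL-Analysis.Analysis"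
    "HOL-Computational_Algebra.Polynomial"
    "HOL-Algebra.Generated_Groups"
    "HOL-Algebra.Group_Action"
    "HOL-Algebra.Bij"
begin

text \<open>The parameter space of Killing 2-tensors: a point is a tuple
  \<open>(A, B, C, \<alpha>, \<beta>, \<gamma>)\<close>.\<close>

type_synonym ktensor = "real \<times> real \<times> real \<times> real \<times> real \<times> real"

text \<open>Symmetric 2-tensor fields on the plane are given by their contravariant
  components in Cartesian coordinates \<open>q $ 1 = x\<close>, \<open>q $ 2 = y\<close>.\<close>

type_synonym tensor_field = "real ^ 2 \<Rightarrow> real ^ 2 ^ 2"

definition euclid_metric :: "real ^ 2 ^ 2" where
  "euclid_metric = mat 1"

fun killing_tensor :: "ktensor \<Rightarrow> tensor_field" where
  "killing_tensor (A, B, C, \<alpha>, \<beta>, \<gamma>) q =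
     (let x = q $ 1; y = q $ 2;
          K12 = C - \<alpha> * x - \<beta> * y - \<gamma> * x * y
      in vector [vector [A + 2 * \<alpha> * y + \<gamma> * y\<^sup>2, K12],
                 vector [K12, B + 2 * \<beta> * x + \<gamma> * x\<^sup>2]])"

lemma inj_killing_tensor: "inj killing_tensor"
proof (rule injI)
  fix p p' assume eq: "killing_tensor p = killing_tensor p'"
  obtain A B C a b c where p: "p = (A, B, C, a, b, c)" by (metis prod.exhaust)
  obtain A' B' C' a' b' c' where p': "p' = (A', B', C', a', b', c')" by (metis prod.exhaust)
  have e: "killing_tensor p (vector [x, y]) $ i $ j = killing_tensor p' (vector [x, y]) $ i $ j" for x y i j
    by (simp add: eq)
  show "p = p'"
    using e[of 0 0 1 1] e[of 0 0 1 2] e[of 0 0 2 2] e[of 0 1 1 1] e[of 0 "-1" 1 1]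
      e[of 1 0 2 2] e[of "-1" 0 2 2]
    by (simp add: p p' Let_def)
qed

text \<open>Roots are taken in \<open>\<complex>\<close>, so that reality of the eigenvalues is a genuine condition.\<close>

definition char_polynomial :: "real ^ 2 ^ 2 \<Rightarrow> complex poly" where
  "char_polynomial T =
     det (\<chi> i j. [: - complex_of_real (T $ i $ j), complex_of_real (euclid_metric $ i $ j) :])"

definition real_simple_eigenvalues :: "real ^ 2 ^ 2 \<Rightarrow> bool" where
  "real_simple_eigenvalues T \<longleftrightarrow>
     (\<forall>z. poly (char_polynomial T) z = 0 \<longrightarrow>
        z \<in> \<real> \<and> Polynomial.order z (char_polynomial T) = 1)"

definition eigenvector :: "real ^ 2 ^ 2 \<Rightarrow> real ^ 2 \<Rightarrow> bool" where
  "eigenvector T v \<longleftrightarrow> v \<noteq> 0 \<and> (\<exists>\<mu>. T *v v = \<mu> *\<^sub>R (euclid_metric *v v))"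

text \<open>A vector field \<open>X\<close> is normal on \<open>W\<close> if locally it is orthogonal to the level sets of a
  function \<open>h\<close> without critical points, i.e. \<open>dh\<close> is a nonvanishing multiple of the 1-form
  associated with \<open>X\<close>. The Euclidean metric is the inner product.\<close>

definition normal_field :: "(real ^ 2) set \<Rightarrow> (real ^ 2 \<Rightarrow> real ^ 2) \<Rightarrow> bool" where
  "normal_field W X \<longleftrightarrow>
     (\<forall>q\<in>W. \<exists>N h f. open N \<and> q \<in> N \<and> N \<subseteq> W \<and> continuous_on N f \<and>
        (\<forall>r\<in>N. f r \<noteq> 0 \<and> (h has_derivative (\<lambda>v. f r * (X r \<bullet> v))) (at r)))"

text \<open>The tensors defining e.g. the polar or the elliptic-hyperbolic web have isolated points
  where the eigenvalues coincide; hence the conditions are imposed on an open dense set.\<close>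

definition characteristic :: "tensor_field \<Rightarrow> bool" where
  "characteristic K \<longleftrightarrow>
     (\<exists>U. open U \<and> closure U = UNIV \<and>
        (\<forall>q\<in>U. real_simple_eigenvalues (K q)) \<and>
        (\<forall>W X. open W \<and> W \<subseteq> U \<and> continuous_on W X \<and> (\<forall>q\<in>W. eigenvector (K q) (X q))
           \<longrightarrow> normal_field W X))"

fun V1 :: "ktensor \<Rightarrow> ktensor" where
  "V1 (A, B, C, \<alpha>, \<beta>, \<gamma>) = (0, - 2 * \<beta>, \<alpha>, 0, - \<gamma>, 0)"

fun V2 :: "ktensor \<Rightarrow> ktensor" where
  "V2 (A, B, C, \<alpha>, \<beta>, \<gamma>) = (- 2 * \<alpha>, 0, \<beta>, - \<gamma>, 0, 0)"

fun V3 :: "ktensor \<Rightarrow> ktensor" where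
  "V3 (A, B, C, \<alpha>, \<beta>, \<gamma>) = (- 2 * C, 2 * C, A - B, \<beta>, - \<alpha>, 0)"

fun V4 :: "ktensor \<Rightarrow> ktensor" where
  "V4 (A, B, C, \<alpha>, \<beta>, \<gamma>) = (2 * A, 2 * B, 2 * C, \<alpha>, \<beta>, 0)"

fun V5 :: "ktensor \<Rightarrow> ktensor" where
  "V5 (A, B, C, \<alpha>, \<beta>, \<gamma>) = (1, 1, 0, 0, 0, 0)"

fun V6 :: "ktensor \<Rightarrow> ktensor" where
  "V6 (A, B, C, \<alpha>, \<beta>, \<gamma>) = (A, B, C, \<alpha>, \<beta>, \<gamma>)"

definition web_fields :: "(ktensor \<Rightarrow> ktensor) set" where
  "web_fields = {V1, V2, V3, V4, V5, V6}"

definition \<Delta>_E :: "ktensor \<Rightarrow> ktensor set" where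
  "\<Delta>_E p = span {V p | V. V \<in> web_fields}"

definition rank_at :: "(ktensor \<Rightarrow> ktensor set) \<Rightarrow> ktensor \<Rightarrow> nat" where
  "rank_at \<Delta> p = dim (\<Delta> p)"

text \<open>All the fields above are affine, hence complete, so only global flows are needed.\<close>

definition is_flow :: "(ktensor \<Rightarrow> ktensor) \<Rightarrow> (real \<Rightarrow> ktensor \<Rightarrow> ktensor) \<Rightarrow> bool" where
  "is_flow V \<phi> \<longleftrightarrow>
     (\<forall>p. \<phi> 0 p = p) \<and>
     (\<forall>s t p. \<phi> (s + t) p = \<phi> s (\<phi> t p)) \<and>
     (\<forall>t p. ((\<lambda>s. \<phi> s p) has_vector_derivative V (\<phi> t p)) (at t))"

text \<open>Explicit flows, witnessing that each of the six fields has a flow.\<close>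

definition flow_V1 :: "real \<Rightarrow> ktensor \<Rightarrow> ktensor" where
  "flow_V1 t = (\<lambda>(A, B, C, \<alpha>, \<beta>, \<gamma>).
     (A, B - 2 * \<beta> * t + \<gamma> * t\<^sup>2, C + \<alpha> * t, \<alpha>, \<beta> - \<gamma> * t, \<gamma>))"

definition flow_V2 :: "real \<Rightarrow> ktensor \<Rightarrow> ktensor" where
  "flow_V2 t = (\<lambda>(A, B, C, \<alpha>, \<beta>, \<gamma>).
     (A - 2 * \<alpha> * t + \<gamma> * t\<^sup>2, B, C + \<beta> * t, \<alpha> - \<gamma> * t, \<beta>, \<gamma>))"

definition flow_V3 :: "real \<Rightarrow> ktensor \<Rightarrow> ktensor" where
  "flow_V3 t = (\<lambda>(A, B, C, \<alpha>, \<beta>, \<gamma>).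
     let D = (A - B) / 2 * cos (2 * t) - C * sin (2 * t)
     in ((A + B) / 2 + D, (A + B) / 2 - D, (A - B) / 2 * sin (2 * t) + C * cos (2 * t),
         \<alpha> * cos t + \<beta> * sin t, \<beta> * cos t - \<alpha> * sin t, \<gamma>))"

definition flow_V4 :: "real \<Rightarrow> ktensor \<Rightarrow> ktensor" where
  "flow_V4 t = (\<lambda>(A, B, C, \<alpha>, \<beta>, \<gamma>).
     (A * exp (2 * t), B * exp (2 * t), C * exp (2 * t), \<alpha> * exp t, \<beta> * exp t, \<gamma>))"

definition flow_V5 :: "real \<Rightarrow> ktensor \<Rightarrow> ktensor" where
  "flow_V5 t = (\<lambda>(A, B, C, \<alpha>, \<beta>, \<gamma>). (A + t, B + t, C, \<alpha>, \<beta>, \<gamma>))"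

definition flow_V6 :: "real \<Rightarrow> ktensor \<Rightarrow> ktensor" where
  "flow_V6 t = (\<lambda>(A, B, C, \<alpha>, \<beta>, \<gamma>).
     (A * exp t, B * exp t, C * exp t, \<alpha> * exp t, \<beta> * exp t, \<gamma> * exp t))"

lemma is_flow_V1: "is_flow V1 flow_V1"
  unfolding is_flow_def flow_V1_def
  by (auto intro!: derivative_eq_intros has_vector_derivative_Pair
      simp: has_real_derivative_iff_has_vector_derivative [symmetric] algebra_simps power2_eq_square)

lemma is_flow_V2: "is_flow V2 flow_V2"
  unfolding is_flow_def flow_V2_def
  by (auto intro!: derivative_eq_intros has_vector_derivative_Pair
      simp: has_real_derivative_iff_has_vector_derivative [symmetric] zero_prod_def algebra_simps power2_eq_square)

lemma is_flow_V3: "is_flow V3 flow_V3"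
  unfolding is_flow_def flow_V3_def Let_def
  by (auto intro!: derivative_eq_intros has_vector_derivative_Pair
      simp: has_real_derivative_iff_has_vector_derivative [symmetric] zero_prod_def algebra_simps
        sin_add cos_add distrib_left diff_divide_distrib add_divide_distrib)

lemma is_flow_V4: "is_flow V4 flow_V4"
  unfolding is_flow_def flow_V4_def
  by (auto intro!: derivative_eq_intros has_vector_derivative_Pair
      simp: has_real_derivative_iff_has_vector_derivative [symmetric] zero_prod_def exp_add distrib_left)

lemma is_flow_V5: "is_flow V5 flow_V5"
  unfolding is_flow_def flow_V5_def
  by (auto intro!: derivative_eq_intros has_vector_derivative_Pair
      simp: has_real_derivative_iff_has_vector_derivative [symmetric] zero_prod_def)

lemma is_flow_V6: "is_flow V6 flow_V6"
  unfolding is_flow_def flow_V6_def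
  by (auto intro!: derivative_eq_intros has_vector_derivative_Pair
      simp: has_real_derivative_iff_has_vector_derivative [symmetric] zero_prod_def exp_add)

definition web_generators :: "(ktensor \<Rightarrow> ktensor) set" where
  "web_generators = {\<phi> t | V \<phi> t. V \<in> web_fields \<and> is_flow V \<phi>} \<union> {uminus}"

definition G_E :: "(ktensor \<Rightarrow> ktensor) monoid" where
  "G_E = (BijGroup UNIV)\<lparr>carrier := generate (BijGroup UNIV) web_generators\<rparr>"

lemma web_generators_subset: "web_generators \<subseteq> carrier (BijGroup UNIV)"
proof -
  have "bij (\<phi> t)" if "is_flow V \<phi>" for V \<phi> and t :: real
    using that unfolding is_flow_def
    by (intro o_bij[of "\<phi> (- t)"]) (auto simp: fun_eq_iff, metis add.left_inverse, metis add.right_inverse)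
  then show ?thesis
    by (auto simp: web_generators_def BijGroup_def Bij_def bij_uminus)
qed

definition S_3 :: "ktensor set" where
  "S_3 = {(A, B, C, \<alpha>, \<beta>, \<gamma>). \<alpha> = 0 \<and> \<beta> = 0 \<and> \<gamma> = 0 \<and> C = 0 \<and> A = B}"

end

theory Submission
  imports Defs
begin

text \<open>
  \<open>S_3\<close> is the line through the metric, and it is the kernel of the linear map \<open>metric_defect\<close>,
  which measures how far a Killing tensor is from a multiple of the metric. At \<open>\<tau> \<^bold>g\<close> the two
  translation fields and the rotation field vanish, while the dilatation field, the scaling field
  and \<open>V5\<close> are all multiples of the metric, and \<open>V5\<close> is never zero; hence the rank is one.

  Since the fields are tangent to \<open>S_3\<close>, their flows should preserve it. The group is generated by
  \<^emph>\<open>all\<close> functions satisfying the flow axioms, so this has to follow from the differential equation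
  rather than from explicit formulas. Each field \<open>V\<close> satisfies
  \<open>\<bar>metric_defect p \<bullet> metric_defect (V p)\<bar> \<le> 4 * (metric_defect p \<bullet> metric_defect p)\<close>, so a
  Gronwall argument shows that the squared defect stays zero along a flow line once it is zero
  (\<open>flow_preserves_kernel\<close>). Sign change preserves the line as well, and inverses
  of generators are generators, so the whole group preserves \<open>S_3\<close>. Conversely, the flow of \<open>V5\<close> alone moves the zero tensor to every multiple of the metric,
  which makes \<open>S_3\<close> a single orbit.

  Finally, the characteristic polynomial of \<open>\<tau> \<^bold>g\<close> is \<open>(z - \<tau>)\<^sup>2\<close> at every point, so the eigenvalues
  are nowhere simple.
\<close>

section \<open>Invariance of a kernel under a flow\<close>

text \<open>Multiplying \<open>f\<close> by \<open>exp (- K t)\<close> gives a function decreasing for \<open>t \<ge> 0\<close>, and multiplying by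
  \<open>exp (K t)\<close> one increasing for \<open>t \<le> 0\<close>; both are squeezed between \<open>0\<close> and their value at \<open>0\<close>.\<close>

lemma gronwall_zero:
  fixes f f' :: "real \<Rightarrow> real"
  assumes deriv: "\<And>t. (f has_real_derivative f' t) (at t)"
    and bound: "\<And>t. \<bar>f' t\<bar> \<le> K * f t"
    and nonneg: "\<And>t. 0 \<le> f t"
    and init: "f 0 = 0"
  shows "f t = 0"
proof (cases "0 \<le> t")
  case True
  have "f t * exp (- K * t) \<le> f 0 * exp (- K * 0)"
  proof (rule DERIV_nonpos_imp_nonincreasing[OF True])
    fix x
    have "((\<lambda>t. f t * exp (- K * t)) has_real_derivative (f' x - K * f x) * exp (- K * x)) (at x)"
      by (auto intro!: derivative_eq_intros deriv simp: algebra_simps)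
    moreover have "(f' x - K * f x) * exp (- K * x) \<le> 0"
      using bound[of x] by (intro mult_nonpos_nonneg) auto
    ultimately show "\<exists>y. ((\<lambda>t. f t * exp (- K * t)) has_real_derivative y) (at x) \<and> y \<le> 0"
      by blast
  qed
  then show ?thesis
    using nonneg[of t] by (simp add: init mult_le_0_iff)
next
  case False
  then have "t \<le> 0" by simp
  then have "f t * exp (K * t) \<le> f 0 * exp (K * 0)"
  proof (rule DERIV_nonneg_imp_nondecreasing)
    fix x
    have "((\<lambda>t. f t * exp (K * t)) has_real_derivative (f' x + K * f x) * exp (K * x)) (at x)"
      by (auto intro!: derivative_eq_intros deriv simp: algebra_simps)
    moreover have "0 \<le> (f' x + K * f x) * exp (K * x)"
      using bound[of x] by (intro mult_nonneg_nonneg) auto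
    ultimately show "\<exists>y. ((\<lambda>t. f t * exp (K * t)) has_real_derivative y) (at x) \<and> 0 \<le> y"
      by blast
  qed
  then show ?thesis
    using nonneg[of t] by (simp add: init mult_le_0_iff)
qed

text \<open>The bound says that the logarithmic growth rate of \<open>\<parallel>L p\<parallel>\<close> along \<open>V\<close> is bounded, so a flow
  line cannot leave the kernel of \<open>L\<close> in finite time.\<close>

lemma flow_preserves_kernel:
  fixes L :: "ktensor \<Rightarrow> 'a::euclidean_space"
  assumes flow: "is_flow V \<phi>"
    and lin: "bounded_linear L"
    and bound: "\<And>q. \<bar>L q \<bullet> L (V q)\<bar> \<le> c * (L q \<bullet> L q)"
    and ker: "L p = 0"
  shows "L (\<phi> t p) = 0"
proof -
  have deriv: "((\<lambda>s. L (\<phi> s p)) has_vector_derivative L (V (\<phi> s p))) (at s)" for s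
    using flow unfolding is_flow_def
    by (intro bounded_linear.has_vector_derivative[OF lin]) blast
  have "L (\<phi> t p) \<bullet> L (\<phi> t p) = 0"
  proof (rule gronwall_zero[where K = "2 * c" and f = "\<lambda>s. L (\<phi> s p) \<bullet> L (\<phi> s p)"
        and f' = "\<lambda>s. 2 * (L (\<phi> s p) \<bullet> L (V (\<phi> s p)))"])
    show "((\<lambda>s. L (\<phi> s p) \<bullet> L (\<phi> s p)) has_real_derivative
        2 * (L (\<phi> s p) \<bullet> L (V (\<phi> s p)))) (at s)" for s
      using bounded_bilinear.has_vector_derivative[OF bounded_bilinear_inner deriv deriv, of s]
      by (simp add: has_real_derivative_iff_has_vector_derivative inner_commute)
    show "\<bar>2 * (L (\<phi> s p) \<bullet> L (V (\<phi> s p)))\<bar> \<le> 2 * c * (L (\<phi> s p) \<bullet> L (\<phi> s p))" for s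
      using bound[of "\<phi> s p"] by (simp add: abs_mult)
    show "L (\<phi> 0 p) \<bullet> L (\<phi> 0 p) = 0"
      using flow ker by (simp add: is_flow_def del: split_paired_All)
  qed simp
  then show ?thesis by simp
qed

section \<open>The multiples of the metric form an orbit\<close>

fun metric_defect :: "ktensor \<Rightarrow> ktensor" where
  "metric_defect (A, B, C, \<alpha>, \<beta>, \<gamma>) = (A - B, 0, C, \<alpha>, \<beta>, \<gamma>)"

lemma bounded_linear_metric_defect: "bounded_linear metric_defect"
  unfolding linear_conv_bounded_linear[symmetric]
  by (rule linearI) (auto simp: algebra_simps)

lemma S_3_iff_metric_defect: "p \<in> S_3 \<longleftrightarrow> metric_defect p = 0"
  by (cases p) (auto simp: S_3_def zero_prod_def)

lemma S_3_eq_range: "S_3 = range (\<lambda>a. (a, a, 0, 0, 0, 0))"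
  by (auto simp: S_3_def)

text \<open>The left side is a quadratic form in the components of the defect, because \<open>A\<close> and \<open>B\<close> enter
  the defect of \<open>V p\<close> only through \<open>A - B\<close>; Young's inequality bounds the mixed products. The
  constant \<open>4\<close> is a convenient common bound, not a sharp one.\<close>

lemma web_field_defect_bound:
  assumes "V \<in> web_fields"
  shows "\<bar>metric_defect p \<bullet> metric_defect (V p)\<bar> \<le> 4 * (metric_defect p \<bullet> metric_defect p)"
proof -
  obtain A B C a b g where p: "p = (A, B, C, a, b, g)" by (metis prod.exhaust)
  define D where "D = A - B"
  have young: "2 * \<bar>x * y\<bar> \<le> x * x + y * y" for x y :: real
    using sum_squares_bound[of "\<bar>x\<bar>" "\<bar>y\<bar>"] by (simp add: power2_eq_square abs_mult mult.assoc)
  have norm: "metric_defect p \<bullet> metric_defect p = D * D + C * C + a * a + b * b + g * g"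
    by (simp add: p D_def)
  have sq: "0 \<le> D * D" "0 \<le> C * C" "0 \<le> a * a" "0 \<le> b * b" "0 \<le> g * g" by simp_all
  consider "V = V1" | "V = V2" | "V = V3" | "V = V4" | "V = V5" | "V = V6"
    using assms by (auto simp: web_fields_def)
  then show ?thesis
  proof cases
    case 1
    have "metric_defect p \<bullet> metric_defect (V p) = 2 * (D * b) + C * a - b * g"
      by (simp add: p 1 D_def algebra_simps)
    then show ?thesis using young[of D b] young[of C a] young[of b g] sq norm by linarith
  next
    case 2
    have "metric_defect p \<bullet> metric_defect (V p) = - 2 * (D * a) + C * b - a * g"
      by (simp add: p 2 D_def algebra_simps)
    then show ?thesis using young[of D a] young[of C b] young[of a g] sq norm by linarith
  next
    case 3
    have "metric_defect p \<bullet> metric_defect (V p) = - 3 * (D * C)"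
      by (simp add: p 3 D_def algebra_simps)
    then show ?thesis using young[of D C] sq norm by linarith
  next
    case 4
    have "metric_defect p \<bullet> metric_defect (V p) = 2 * (D * D) + 2 * (C * C) + a * a + b * b"
      by (simp add: p 4 D_def algebra_simps)
    then show ?thesis using sq norm by linarith
  next
    case 5
    have "metric_defect p \<bullet> metric_defect (V p) = 0"
      by (simp add: p 5)
    then show ?thesis using sq norm by linarith
  next
    case 6
    have "metric_defect p \<bullet> metric_defect (V p) = metric_defect p \<bullet> metric_defect p"
      by (simp add: p 6)
    then show ?thesis using sq norm by linarith
  qed
qed

lemma flow_preserves_S_3:
  assumes "V \<in> web_fields" "is_flow V \<phi>" "p \<in> S_3"
  shows "\<phi> t p \<in> S_3"
  using flow_preserves_kernel[OF assms(2) bounded_linear_metric_defect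
      web_field_defect_bound[OF assms(1)]] assms(3)
  by (simp add: S_3_iff_metric_defect)

lemma web_generator_preserves_S_3:
  assumes "h \<in> web_generators" "p \<in> S_3"
  shows "h p \<in> S_3"
proof -
  from assms(1) consider "h = uminus" | V \<phi> t where "h = \<phi> t" "V \<in> web_fields" "is_flow V \<phi>"
    unfolding web_generators_def by blast
  then show ?thesis
  proof cases
    case 1
    then show ?thesis using assms(2) by (auto simp: S_3_def)
  next
    case 2
    then show ?thesis using flow_preserves_S_3 assms(2) by simp
  qed
qed

text \<open>Time reversal makes the generating set closed under inverses.\<close>

lemma inv_web_generator:
  assumes "h \<in> web_generators"
  shows "inv\<^bsub>BijGroup UNIV\<^esub> h \<in> web_generators"
proof -
  have bij: "h \<in> Bij UNIV"
    using assms web_generators_subset by (auto simp: BijGroup_def)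
  obtain k where k: "k \<in> web_generators" "\<And>p. h (k p) = p" "\<And>p. k (h p) = p"
  proof (cases "h = uminus")
    case True
    then show ?thesis using that[of uminus] by (simp add: web_generators_def)
  next
    case False
    then obtain V \<phi> t where h: "h = \<phi> t" "V \<in> web_fields" "is_flow V \<phi>"
      using assms unfolding web_generators_def by blast
    have "\<phi> s (\<phi> (- s) p) = p" for s p
      using h(3) unfolding is_flow_def by (metis add.right_inverse)
    moreover from this[of "- t"] have "\<phi> (- t) (\<phi> t p) = p" for p
      by simp
    moreover have "\<phi> (- t) \<in> web_generators"
      using h(2,3) unfolding web_generators_def by blast
    ultimately show ?thesis
      using that unfolding h(1) by blast
  qed
  have "inv\<^bsub>BijGroup UNIV\<^esub> h = inv_into UNIV h"
    using inv_BijGroup[OF bij] by (simp add: restrict_def)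
  also have "\<dots> = k"
    by (rule inv_unique_comp; rule ext) (simp_all only: comp_apply id_apply k)
  finally show ?thesis using k(1) by simp
qed

lemma G_E_preserves_S_3:
  assumes "g \<in> carrier G_E" "p \<in> S_3"
  shows "g p \<in> S_3"
proof -
  have "g \<in> generate (BijGroup UNIV) web_generators"
    using assms(1) by (simp add: G_E_def)
  then show ?thesis using assms(2)
  proof (induction arbitrary: p)
    case one
    then show ?case by (simp add: BijGroup_def)
  next
    case (incl h)
    then show ?case by (rule web_generator_preserves_S_3)
  next
    case (inv h)
    then show ?case by (rule web_generator_preserves_S_3[OF inv_web_generator])
  next
    case (eng h1 h2)
    have "h1 \<in> carrier (BijGroup UNIV)" "h2 \<in> carrier (BijGroup UNIV)"
      using eng.hyps group.generate_in_carrier[OF group_BijGroup web_generators_subset] by blast+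
    then have "(h1 \<otimes>\<^bsub>BijGroup UNIV\<^esub> h2) p = h1 (h2 p)"
      by (simp add: BijGroup_def compose_def)
    then show ?case
      using eng.IH(1)[OF eng.IH(2)[OF eng.prems]] by simp
  qed
qed

text \<open>The zero tensor is a base point from which the flow of \<open>V5\<close> reaches all of \<open>S_3\<close>.\<close>

lemma S_3_eq_orbit: "S_3 = orbit G_E (\<lambda>g. g) 0"
proof
  show "orbit G_E (\<lambda>g. g) 0 \<subseteq> S_3"
  proof -
    have "0 \<in> S_3" by (simp add: S_3_def zero_prod_def)
    then show ?thesis using G_E_preserves_S_3 unfolding orbit_def by blast
  qed
  show "S_3 \<subseteq> orbit G_E (\<lambda>g. g) 0"
  proof
    fix p assume "p \<in> S_3"
    then obtain a where "p = (a, a, 0, 0, 0, 0)" by (auto simp: S_3_eq_range)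
    then have "p = flow_V5 a 0" by (simp add: flow_V5_def zero_prod_def)
    moreover have "flow_V5 a \<in> carrier G_E"
      using is_flow_V5 by (auto simp: G_E_def web_generators_def web_fields_def intro!: generate.incl)
    ultimately show "p \<in> orbit G_E (\<lambda>g. g) 0" by (auto simp: orbit_def)
  qed
qed

section \<open>Rank and failure of the characteristic property\<close>

lemma rank_on_S_3:
  assumes "p \<in> S_3"
  shows "rank_at \<Delta>_E p = 1"
proof -
  obtain a where p: "p = (a, a, 0, 0, 0, 0)" using assms by (auto simp: S_3_eq_range)
  define e :: ktensor where "e = (1, 1, 0, 0, 0, 0)"
  have "{V p | V. V \<in> web_fields} = {V1 p, V2 p, V3 p, V4 p, V5 p, V6 p}"
    by (auto simp: web_fields_def)
  also have "\<dots> = {0, (2 * a) *\<^sub>R e, e, a *\<^sub>R e}"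
    by (auto simp: p e_def zero_prod_def)
  finally have "\<Delta>_E p = span {0, (2 * a) *\<^sub>R e, e, a *\<^sub>R e}"
    by (simp add: \<Delta>_E_def)
  also have "\<dots> = span {e}"
    by (intro span_eq[THEN iffD2]) (auto intro: span_base span_scale span_zero)
  finally have "rank_at \<Delta>_E p = dim {e}" by (simp add: rank_at_def)
  also have "\<dots> = 1" by (simp add: e_def zero_prod_def)
  finally show ?thesis .
qed

lemma killing_tensor_metric:
  "killing_tensor (\<tau>, \<tau>, 0, 0, 0, 0) = (\<lambda>q. \<tau> *\<^sub>R euclid_metric)"
  by (auto simp: fun_eq_iff vec_eq_iff forall_2 euclid_metric_def mat_def)

lemma char_polynomial_metric:
  "char_polynomial (\<tau> *\<^sub>R euclid_metric) = [: - complex_of_real \<tau>, 1 :] ^ 2"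
  by (simp add: char_polynomial_def det_2 euclid_metric_def mat_def power2_eq_square)

lemma not_characteristic_metric: "\<not> characteristic (\<lambda>q. \<tau> *\<^sub>R euclid_metric)"
proof
  assume "characteristic (\<lambda>q. \<tau> *\<^sub>R euclid_metric)"
  then obtain U :: "(real ^ 2) set" where "closure U = UNIV"
    and U: "\<forall>q\<in>U. real_simple_eigenvalues (\<tau> *\<^sub>R euclid_metric)"
    unfolding characteristic_def by blast
  \<comment> \<open>a dense set is nonempty, so the pointwise condition is not vacuous\<close>
  then obtain q where "q \<in> U" by (metis closure_empty empty_not_UNIV equals0I)
  then have "real_simple_eigenvalues (\<tau> *\<^sub>R euclid_metric)"
    using U by blast
  then have "Polynomial.order (complex_of_real \<tau>) (char_polynomial (\<tau> *\<^sub>R euclid_metric)) = 1"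
    by (simp add: real_simple_eigenvalues_def char_polynomial_metric)
  then show False
    by (simp add: char_polynomial_metric order_power_n_n)
qed

theorem proposition10:
  shows "(\<forall>p\<in>S_3. rank_at \<Delta>_E p = 1) \<and>
    S_3 \<in> orbits G_E UNIV (\<lambda>g. g) \<and>
    (\<forall>\<tau>::real. \<exists>p\<in>S_3. killing_tensor p = (\<lambda>q. \<tau> *\<^sub>R euclid_metric) \<and>
       \<not> characteristic (killing_tensor p))"
proof (intro conjI ballI allI)
  show "rank_at \<Delta>_E p = 1" if "p \<in> S_3" for p
    using that by (rule rank_on_S_3)
  show "S_3 \<in> orbits G_E UNIV (\<lambda>g. g)"
    using S_3_eq_orbit unfolding orbits_def by blast
  show "\<exists>p\<in>S_3. killing_tensor p = (\<lambda>q. \<tau> *\<^sub>R euclid_metric) \<and>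
      \<not> characteristic (killing_tensor p)" for \<tau>
    by (rule bexI[of _ "(\<tau>, \<tau>, 0, 0, 0, 0)"])
      (simp_all only: killing_tensor_metric not_characteristic_metric, simp_all add: S_3_eq_range)
qed

end
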